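(* Let $\mathcal{H}$ be a real Hilbert space and let $T:\mathcal{H}\to\mathcal{H}$ be a Banach contraction, i.e., there exists $\gamma\in[0,1[$ such that $$(\forall x\in\mathcal{H})(\forall y\in\mathcal{H})\quad\|Tx-Ty\|\le\gamma\|x-y\|.$$ Then $T$ is a $\gamma$-BAM.
   Context: For a nonempty closed convex set $C\subseteq\mathcal{H}$, $\mathrm{P}_C$ denotes the metric projection onto $C$. $\operatorname{Fix}G=\{x\in\mathcal{H}: Gx=x\}$. Definition (BAM). Let $G:\mathcal{H}\to\mathcal{H}$ and $\gamma\in[0,1[$. $G$ is a best approximation mapping with constant $\gamma$ ($\gamma$-BAM) if (1) $\operatorname{Fix}G$ is a nonempty closed convex subset of $\mathcal{H}$; (2) $\mathrm{P}_{\operatorname{Fix}G}G=\mathrm{P}_{\operatorname{Fix}G}$; (3) $\|Gx-\mathrm{P}_{\operatorname{Fix}G}x\|\le\gamma\|x-\mathrm{P}_{\operatorname{Fix}G}x\|$ for all $x\in\mathcal{H}$. *)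

theory Defs
  imports "HOL-Analysis.Analysis"
begin

text \<open>
  A real Hilbert space is a type of sort \<open>{real_inner, complete_space}\<close>.

  The library's \<open>closest_point\<close> requires class \<open>heine_borel\<close>, i.e. finite dimension, so the
  metric projection is defined here for inner product spaces. In a Hilbert space
  the description denotes a unique point whenever \<open>C\<close> is nonempty, closed and convex (projection
  theorem); for other sets \<open>C\<close> it may be unspecified.
\<close>

definition metric_projection :: "'a::real_inner set \<Rightarrow> 'a \<Rightarrow> 'a"
  where "metric_projection C x = (THE p. p \<in> C \<and> (\<forall>y\<in>C. norm (x - p) \<le> norm (x - y)))"

definition Fix :: "('a \<Rightarrow> 'a) \<Rightarrow> 'a set"
  where "Fix G = {x. G x = x}"

definition is_BAM :: "real \<Rightarrow> ('a::{real_inner, complete_space} \<Rightarrow> 'a) \<Rightarrow> bool"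
  where "is_BAM \<gamma> G \<longleftrightarrow>
    0 \<le> \<gamma> \<and> \<gamma> < 1 \<and>
    Fix G \<noteq> {} \<and> closed (Fix G) \<and> convex (Fix G) \<and>
    metric_projection (Fix G) \<circ> G = metric_projection (Fix G) \<and>
    (\<forall>x. norm (G x - metric_projection (Fix G) x) \<le> \<gamma> * norm (x - metric_projection (Fix G) x))"

end

theory Submission
  imports Defs
begin

text \<open>By completeness, Banach's theorem makes \<open>Fix T\<close> a singleton
  \<open>{z}\<close>, which is closed and convex. Its projection is the constant map
  \<open>z\<close>, so composing it with \<open>T\<close> changes nothing.\<close>

lemma metric_projection_singleton: "metric_projection {z} x = z"
  unfolding metric_projection_def by (rule the_equality) auto

theorem proposition3p7:
  fixes T :: "'a::{real_inner, complete_space} \<Rightarrow> 'a" and \<gamma> :: real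
  assumes "0 \<le> \<gamma>" and "\<gamma> < 1"
    and "\<forall>x y. norm (T x - T y) \<le> \<gamma> * norm (x - y)"
  shows "is_BAM \<gamma> T"
proof -
  have "\<exists>!x. T x = x"
    by (rule banach_fix_type[OF assms(1,2)]) (use assms(3) in \<open>simp add: dist_norm\<close>)
  then obtain z where z: "T z = z" and uniq: "\<And>x. T x = x \<Longrightarrow> x = z"
    by auto
  have Fix_T: "Fix T = {z}"
    unfolding Fix_def using z uniq by blast
  show ?thesis
    unfolding is_BAM_def Fix_T
    \<comment> \<open>Contraction with second point \<open>z\<close>: since \<open>T z = z\<close>
      and \<open>z\<close> is the projection of every \<open>x\<close>, this is the BAM
      estimate.\<close>
    using assms(1,2) assms(3)[rule_format, of _ z] z
    by (auto simp: fun_eq_iff metric_projection_singleton)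
qed

end
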